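(* Let $R=(R(t))_{t\ge 0}$ be a risk reserve process with $R(0)=u>0$ satisfying conditions (i)--(iv) of the context. Put $v_0:=1$, $v_k:=\prod_{j=1}^k\frac{1}{1+r_j}$, $S_0^*:=0$ and $S_k^*:=\sum_{j=1}^k v_{j-1}Y_j^*$ for $k\ge1$. Suppose that there exist an integer $l\ge1$ and a real number $q_l>0$ such that for all $n=1,2,\ldots$ the random variables $Y_{n+l}^*$ and $q_lY_n^*$ are identically distributed. Assume also that for each $n\ge 1$ $$q_lv_l\le 1\quad\text{and}\quad r_{n+l}=r_n,$$ and set $$L(S_l^* ):=\sup\big\{h\ge 0:\ \mathbf{E}e^{hS_l^*}\le 1\big\}.$$ Then for any $h\in[0,L(S_l^* )]$ and any $u>0$ $$\psi(u)\le e^{-hu}\sup_{k\ge1}\mathbf{E}e^{hS_k^*}=e^{-hu}\sup_{k\ge 1}\prod_{j=1}^k\mathbf{E}e^{hv_{j-1}Y_j^*}\qquad\text{with}\qquad \sup_{k\ge 1}\mathbf{E}e^{hS_k^*}\le\max_{0\le k<l}\mathbf{E}e^{hS_k^*}.$$ And for any $u>0$ the following Lundberg-type inequality holds: $$\psi(u)\le\inf_{h\in[0,L(S_l^* )]}\Big\{e^{-hu}\max_{0\le k<l}\mathbf{E}e^{hS_k^*}\Big\}\le C_3e^{-L(S_l^* )u}\qquad\text{with}\qquad C_3=\max_{0\le k<l}\mathbf{E}e^{L(S_l^* )S_k^*}.$$ Moreover, if $q_lv_l=1$, then for all $h\in[0,L(S_l^* )]$ $$\sup_{k\ge1}\mathbf{E}e^{hS_k^*}=\max_{1\le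 k\le l}\mathbf{E}e^{hS_k^*}.$$
   Context: $R(t)$, $t\ge 0$, is a risk reserve process (a real-valued stochastic process) with non-random initial reserve $R(0)=u>0$. The ultimate ruin probability is $\psi(u):=\mathbf{P}[\inf_{t\ge 0}R(t)<0\mid R(0)=u]$. Conditions: (i) The process $R(t)$ may have positive jumps only at random or non-random times $T_1,T_2,\ldots$ such that $T_{k+1}>T_k>T_0:=0$ for all $k=1,2,\ldots$ and $T_n\to\infty$ almost surely. (ii) The process $R(t)$ is monotone on each time interval $[T_{k-1},T_k)$, $k=1,2,\ldots$, and $R(0)=u>0$. (iii) For some non-random $r_1,r_2,\ldots$ and random variables $\alpha_k$, $Y_k$, one has for all $k\ge 1$: $R(T_k)\ge(1+\alpha_k)R(T_{k-1})-Y_k$ and $\alpha_k\ge r_k\ge 0$. (iv) The random variables $Y_k^*:=\dfrac{Y_k}{1+\alpha_k}$, $k=1,2,\ldots$, are mutually independent. Convention: expectations $\mathbf{E}e^{hS}$ with $h\ge0$ take values in $(0,\infty]$; an upper bound for $\psi(u)$ may be $+\infty$, in which case it is trivial.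
   Formalization: Added to (i)-(iv), which alone allow unseen ruin: a.s. R has no upward jump at T_k unless it is nondecreasing on [T_{k-1},T_k). The ruin event is assumed measurable. The C_3 bound is not claimed when L and C_3 are both infinite. *)

theory Defs
  imports "HOL-Probability.Probability"
begin

text \<open>
  One-sided upward jumps of a path. The left limit is taken in the extended reals because a path that
  is only known to be monotone on a half-open interval \<open>[a, b)\<close> may tend to an infinite value at \<open>b\<close>.
  Values at negative times are meaningless, hence the guard \<open>0 < t\<close>.
\<close>

definition jumps_up_from_left :: "(real \<Rightarrow> real) \<Rightarrow> real \<Rightarrow> bool" where
  "jumps_up_from_left x t \<longleftrightarrow>
     0 < t \<and> (\<exists>a::ereal. ((\<lambda>s. ereal (x s)) \<longlongrightarrow> a) (at_left t) \<and> a < ereal (x t))"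

definition jumps_up_to_right :: "(real \<Rightarrow> real) \<Rightarrow> real \<Rightarrow> bool" where
  "jumps_up_to_right x t \<longleftrightarrow>
     (\<exists>b::ereal. ((\<lambda>s. ereal (x s)) \<longlongrightarrow> b) (at_right t) \<and> ereal (x t) < b)"

definition positive_jump_at :: "(real \<Rightarrow> real) \<Rightarrow> real \<Rightarrow> bool" where
  "positive_jump_at x t \<longleftrightarrow> jumps_up_from_left x t \<or> jumps_up_to_right x t"

definition Y_star :: "(nat \<Rightarrow> 'a \<Rightarrow> real) \<Rightarrow> (nat \<Rightarrow> 'a \<Rightarrow> real) \<Rightarrow> nat \<Rightarrow> 'a \<Rightarrow> real" where
  "Y_star \<alpha> Y k \<omega> = Y k \<omega> / (1 + \<alpha> k \<omega>)"

definition discount :: "(nat \<Rightarrow> real) \<Rightarrow> nat \<Rightarrow> real" where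
  "discount r k = (\<Prod>j=1..k. 1 / (1 + r j))"

definition S_star ::
    "(nat \<Rightarrow> real) \<Rightarrow> (nat \<Rightarrow> 'a \<Rightarrow> real) \<Rightarrow> (nat \<Rightarrow> 'a \<Rightarrow> real) \<Rightarrow> nat \<Rightarrow> 'a \<Rightarrow> real" where
  "S_star r \<alpha> Y k \<omega> = (\<Sum>j=1..k. discount r (j - 1) * Y_star \<alpha> Y j \<omega>)"

definition ruin :: "(real \<Rightarrow> 'a \<Rightarrow> real) \<Rightarrow> 'a \<Rightarrow> bool" where
  "ruin R \<omega> \<longleftrightarrow> (INF t\<in>{0..}. ereal (R t \<omega>)) < 0"

definition ruin_prob :: "'a measure \<Rightarrow> (real \<Rightarrow> 'a \<Rightarrow> real) \<Rightarrow> real \<Rightarrow> real" where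
  "ruin_prob M R u = \<P>(\<omega> in M. ruin R \<omega> \<bar> R 0 \<omega> = u)"

text \<open>
  Path properties are required almost surely. The sequences \<open>\<alpha>\<close>, \<open>Y\<close>, \<open>r\<close> are indexed from \<open>1\<close>;
  their values at index \<open>0\<close> are irrelevant. Ruin involves an infimum over uncountably many times,
  and measurability of that event does not follow from measurability of the single \<open>R t\<close> when paths
  need not be right-continuous; it is assumed, as otherwise the ruin probability is not defined.
\<close>

locale risk_reserve = prob_space M
  for M :: "'a measure" +
  fixes R :: "real \<Rightarrow> 'a \<Rightarrow> real"
    and u :: real
    and T :: "nat \<Rightarrow> 'a \<Rightarrow> real"
    and \<alpha> Y :: "nat \<Rightarrow> 'a \<Rightarrow> real"
    and r :: "nat \<Rightarrow> real"
  assumes R_measurable: "\<And>t. 0 \<le> t \<Longrightarrow> random_variable borel (R t)"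
    and T_measurable: "\<And>k. random_variable borel (T k)"
    and \<alpha>_measurable: "\<And>k. 1 \<le> k \<Longrightarrow> random_variable borel (\<alpha> k)"
    and Y_measurable: "\<And>k. 1 \<le> k \<Longrightarrow> random_variable borel (Y k)"
    and ruin_measurable: "{\<omega> \<in> space M. ruin R \<omega>} \<in> events"
    and u_pos: "0 < u"
    and R_init: "AE \<omega> in M. R 0 \<omega> = u"
    and T_zero: "AE \<omega> in M. T 0 \<omega> = 0"
    and T_increasing: "AE \<omega> in M. \<forall>k. T k \<omega> < T (Suc k) \<omega>"
    and T_unbounded: "AE \<omega> in M. filterlim (\<lambda>k. T k \<omega>) at_top sequentially"
    and positive_jumps: "AE \<omega> in M. \<forall>t\<ge>0. positive_jump_at (\<lambda>s. R s \<omega>) t \<longrightarrow> (\<exists>k\<ge>1. t = T k \<omega>)"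
    and piecewise_monotone: "AE \<omega> in M. \<forall>k\<ge>1.
          mono_on {T (k - 1) \<omega>..<T k \<omega>} (\<lambda>s. R s \<omega>) \<or>
          antimono_on {T (k - 1) \<omega>..<T k \<omega>} (\<lambda>s. R s \<omega>)"
    and R_step: "\<And>k. 1 \<le> k \<Longrightarrow>
          AE \<omega> in M. R (T k \<omega>) \<omega> \<ge> (1 + \<alpha> k \<omega>) * R (T (k - 1) \<omega>) \<omega> - Y k \<omega>"
    and r_nonneg: "\<And>k. 1 \<le> k \<Longrightarrow> 0 \<le> r k"
    and \<alpha>_ge_r: "\<And>k. 1 \<le> k \<Longrightarrow> AE \<omega> in M. r k \<le> \<alpha> k \<omega>"
    and Y_star_indep: "indep_vars (\<lambda>_. borel) (Y_star \<alpha> Y) {1..}"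

text \<open>
  Ruin has to be visible at the times \<open>T k\<close>. The conditions collected in \<^locale>\<open>risk_reserve\<close> alone do
  not ensure this: a path may decrease below zero on \<open>[T (k - 1), T k)\<close> and be brought back by a
  positive jump at \<open>T k\<close>. This is excluded by forbidding an upward jump at the end of an interval on
  which the path fails to be nondecreasing. If the path is nondecreasing on the interval (in
  particular, if it is constant), upward jumps at \<open>T k\<close> remain unrestricted.
\<close>

definition no_recovery_jumps ::
    "'a measure \<Rightarrow> (real \<Rightarrow> 'a \<Rightarrow> real) \<Rightarrow> (nat \<Rightarrow> 'a \<Rightarrow> real) \<Rightarrow> bool" where
  "no_recovery_jumps M R T \<longleftrightarrow> (AE \<omega> in M. \<forall>k\<ge>1.
     mono_on {T (k - 1) \<omega>..<T k \<omega>} (\<lambda>s. R s \<omega>) \<or>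
     \<not> jumps_up_from_left (\<lambda>s. R s \<omega>) (T k \<omega>))"

text \<open>
  The exponent \<open>h\<close> may be \<open>\<infinity>\<close>, since the supremum in \<open>lundberg_exponent\<close> is infinite when \<open>X \<le> 0\<close>
  almost surely. In \<open>h * ereal (X \<omega>)\<close> the library convention \<open>\<infinity> * 0 = 0\<close> applies, so that
  \<open>exp (\<infinity> * X)\<close> is \<open>0\<close>, \<open>1\<close> or \<open>\<infinity>\<close> according to the sign of \<open>X\<close>.
\<close>

definition exp_ext :: "ereal \<Rightarrow> ennreal" where
  "exp_ext x = (case x of ereal y \<Rightarrow> ennreal (exp y) | PInfty \<Rightarrow> \<infinity> | MInfty \<Rightarrow> 0)"

definition exp_moment :: "'a measure \<Rightarrow> ('a \<Rightarrow> real) \<Rightarrow> ereal \<Rightarrow> ennreal" where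
  "exp_moment M X h = (\<integral>\<^sup>+\<omega>. exp_ext (h * ereal (X \<omega>)) \<partial>M)"

lemma exp_moment_ereal:
  "exp_moment M X (ereal h) = (\<integral>\<^sup>+\<omega>. ennreal (exp (h * X \<omega>)) \<partial>M)"
  by (simp add: exp_moment_def exp_ext_def)

definition lundberg_exponent :: "'a measure \<Rightarrow> ('a \<Rightarrow> real) \<Rightarrow> ereal" where
  "lundberg_exponent M X = (SUP h\<in>{h::real. 0 \<le> h \<and> exp_moment M X (ereal h) \<le> 1}. ereal h)"

end

theory Submission
  imports Defs
begin

text \<open>
  Ruin forces \<open>S\<^sub>k\<^sup>* > u\<close> for some \<open>k\<close>. Dividing \<open>exp (h S\<^sub>k\<^sup>*)\<close> by its mean gives a positive martingale
  of mean one, and stopping it at the first such \<open>k\<close> bounds the probability of this event by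
  \<open>exp (- h u) * sup\<^sub>k E exp (h S\<^sub>k\<^sup>*)\<close>. By periodicity, \<open>E exp (h S\<^sub>l\<^sub>+\<^sub>k\<^sup>*)\<close> is the product of
  \<open>E exp (h S\<^sub>l\<^sup>*)\<close>, which is at most one for \<open>h \<le> L\<close>, and \<open>E exp (a h S\<^sub>k\<^sup>*)\<close> with \<open>a = q\<^sub>l v\<^sub>l \<le> 1\<close>;
  convexity bounds the latter by the larger of \<open>1 = E exp (h S\<^sub>0\<^sup>*)\<close> and \<open>E exp (h S\<^sub>k\<^sup>*)\<close>.
\<close>

section \<open>Pathwise arguments: from ruin to an exceedance by the discounted sum\<close>

text \<open>Before the first negative index all values are nonnegative, so the lower bound survives
  replacing the factor \<open>1 + a k\<close> by the smaller \<open>1 + r k\<close>, and discounting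
  makes the recursion telescope. At the negative index itself only a sign is used, so the true
  factor can stay there.\<close>

lemma first_negative_imp_sum_exceeds:
  fixes x r a y :: "nat \<Rightarrow> real"
  assumes "0 \<le> x 0"
    and step: "\<And>k. 1 \<le> k \<Longrightarrow> x k \<ge> (1 + a k) * x (k - 1) - y k"
    and r: "\<And>k. 1 \<le> k \<Longrightarrow> 0 \<le> r k" "\<And>k. 1 \<le> k \<Longrightarrow> r k \<le> a k"
    and neg: "x n < 0"
  shows "\<exists>k\<ge>1. x 0 < (\<Sum>j=1..k. discount r (j - 1) * (y j / (1 + a j)))"
proof -
  define s where "s k = (\<Sum>j=1..k. discount r (j - 1) * (y j / (1 + a j)))" for k
  define k where "k = (LEAST n. x n < 0)"
  have xk: "x k < 0" unfolding k_def using neg by (rule LeastI)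
  have nonneg: "0 \<le> x j" if "j < k" for j
    using not_less_Least[of j "\<lambda>n. x n < 0"] that unfolding k_def by simp
  have dpos: "0 < discount r j" for j
    unfolding discount_def using r(1) by (intro prod_pos) (auto simp: add_pos_nonneg)
  have dSuc: "discount r (Suc j) * (1 + r (Suc j)) = discount r j" for j
    using r(1)[of "Suc j"] by (simp add: discount_def)
  have step': "(1 + a (Suc j)) * (x j - y (Suc j) / (1 + a (Suc j))) \<le> x (Suc j)" for j
  proof -
    have "1 + a (Suc j) \<noteq> 0" using r(1)[of "Suc j"] r(2)[of "Suc j"] by simp
    then show ?thesis using step[of "Suc j"] by (simp add: right_diff_distrib)
  qed
  \<comment> \<open>Restricted to \<open>j < k\<close> because the induction step uses
    \<open>0 \<le> x (Suc j)\<close>, which fails at \<open>k\<close>.\<close>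
  have disc: "x 0 - s j \<le> discount r j * x j" if "j < k" for j
    using that
  proof (induction j)
    case 0
    show ?case by (simp add: s_def discount_def)
  next
    case (Suc j)
    define d where "d = x j - y (Suc j) / (1 + a (Suc j))"
    have "(1 + r (Suc j)) * d \<le> x (Suc j)"
    \<comment> \<open>For \<open>d \<ge> 0\<close> the smaller factor gives a smaller product; for
      \<open>d < 0\<close> the product is at most zero, hence below the nonnegative
      \<open>x (Suc j)\<close>.\<close>
    proof (cases "0 \<le> d")
      case True
      then have "(1 + r (Suc j)) * d \<le> (1 + a (Suc j)) * d"
        using r(2)[of "Suc j"] by (intro mult_right_mono) auto
      then show ?thesis using step'[of j] by (simp add: d_def)
    next
      case False
      then have "(1 + r (Suc j)) * d \<le> 0"
        using r(1)[of "Suc j"] by (intro mult_nonneg_nonpos) auto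
      then show ?thesis using nonneg[OF Suc.prems] by simp
    qed
    then have "discount r (Suc j) * ((1 + r (Suc j)) * d) \<le> discount r (Suc j) * x (Suc j)"
      using dpos[of "Suc j"] by (intro mult_left_mono) auto
    then have "discount r j * d \<le> discount r (Suc j) * x (Suc j)"
      by (metis dSuc mult.assoc)
    moreover have "x 0 - s j \<le> discount r j * x j" using Suc by simp
    ultimately show ?case by (simp add: s_def d_def algebra_simps)
  qed
  from xk assms(1) obtain i where k: "k = Suc i" by (cases k) auto
  have pos: "0 < 1 + a k" using r(1)[of k] r(2)[of k] k by simp
  \<comment> \<open>The positive factor \<open>1 + a k\<close> is divided out rather than
    discounted. This is why the \<open>k\<close>-th summand carries the weight with index
    \<open>k - 1\<close>.\<close>
  have "(1 + a k) * (x i - y k / (1 + a k)) < 0"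
    using step'[of i] xk k by simp
  then have "x i < y k / (1 + a k)"
    using pos by (simp add: mult_less_0_iff)
  then have "discount r i * x i < discount r i * (y k / (1 + a k))"
    using dpos[of i] by (rule mult_strict_left_mono)
  with disc[of i] have "x 0 < s i + discount r i * (y k / (1 + a k))" using k by simp
  also have "\<dots> = s k" by (simp add: s_def k)
  finally show ?thesis unfolding s_def using k by (intro exI[of _ k]) auto
qed

text \<open>Values in \<open>ereal\<close> let this cover real paths that tend to minus infinity at
  \<open>b\<close>.\<close>

lemma antimono_tendsto_at_left:
  fixes f :: "real \<Rightarrow> ereal"
  assumes "antimono_on {a..<b} f" "a < b"
  shows "(f \<longlongrightarrow> (INF s\<in>{a..<b}. f s)) (at_left b)"
proof (rule decreasing_tendsto)
  show "\<forall>\<^sub>F s in at_left b. (INF s\<in>{a..<b}. f s) \<le> f s"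
    unfolding eventually_at_left_field using assms(2)
    by (intro exI[of _ a]) (auto intro!: INF_lower)
next
  fix y assume "(INF s\<in>{a..<b}. f s) < y"
  then obtain c where c: "a \<le> c" "c < b" "f c < y" by (auto simp: INF_less_iff)
  have "f s < y" if "c < s" "s < b" for s
    using monotone_onD[OF assms(1), of c s] c that by (auto intro: le_less_trans)
  then show "\<forall>\<^sub>F s in at_left b. f s < y"
    unfolding eventually_at_left_field using c by (intro exI[of _ c]) auto
qed

text \<open>Let \<open>t\<close> lie in \<open>[T i, T (Suc i))\<close>. A nondecreasing path is
  already negative at \<open>T i\<close>. Otherwise it is nonincreasing, its left limit at
  \<open>T (Suc i)\<close> is its infimum over the interval and so at most \<open>x t\<close>, and
  the absence of an upward jump keeps the value at \<open>T (Suc i)\<close> below that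
  limit.\<close>

lemma negative_at_grid_time:
  fixes x :: "real \<Rightarrow> real" and T :: "nat \<Rightarrow> real"
  assumes "T 0 = 0" "\<And>k. T k < T (Suc k)" "filterlim T at_top sequentially"
    and mon: "\<And>k. 1 \<le> k \<Longrightarrow> mono_on {T (k - 1)..<T k} x \<or> antimono_on {T (k - 1)..<T k} x"
    and jump: "\<And>k. 1 \<le> k \<Longrightarrow> mono_on {T (k - 1)..<T k} x \<or> \<not> jumps_up_from_left x (T k)"
    and t: "0 \<le> t" "x t < 0"
  shows "\<exists>k. x (T k) < 0"
proof -
  obtain n where n: "t < T n"
    using assms(3) unfolding filterlim_at_top_dense
    by (metis eventually_happens' sequentially_bot)
  define k where "k = (LEAST n. t < T n)"
  have tk: "t < T k" unfolding k_def using n by (rule LeastI)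
  with t assms(1) obtain i where k: "k = Suc i" by (cases k) auto
  have ti: "T i \<le> t"
    using not_less_Least[of i "\<lambda>n. t < T n"] k unfolding k_def by simp
  show ?thesis
  proof (cases "mono_on {T i..<T k} x")
    case True
    then have "x (T i) \<le> x t"
      using ti tk by (auto elim!: mono_onD)
    with t show ?thesis by (intro exI[of _ i]) simp
  next
    case False
    then have anti: "antimono_on {T i..<T k} x" and nojump: "\<not> jumps_up_from_left x (T k)"
      using mon[of k] jump[of k] k by auto
    have lim: "((\<lambda>s. ereal (x s)) \<longlongrightarrow> (INF s\<in>{T i..<T k}. ereal (x s))) (at_left (T k))"
      using anti ti tk by (intro antimono_tendsto_at_left) (auto simp: monotone_on_def)
    have "0 < T k" using t tk by simp
    with nojump lim have "ereal (x (T k)) \<le> (INF s\<in>{T i..<T k}. ereal (x s))"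
      unfolding jumps_up_from_left_def by (meson not_less)
    also have "\<dots> \<le> ereal (x t)" using ti tk by (intro INF_lower) auto
    finally show ?thesis using t by (intro exI[of _ k]) simp
  qed
qed

section \<open>Exponential moments of random variables and of independent sums\<close>

context prob_space
begin

lemma exp_moment_scale:
  "exp_moment M (\<lambda>\<omega>. c * X \<omega>) (ereal h) = exp_moment M X (ereal (h * c))"
  by (simp add: exp_moment_ereal mult.assoc)

lemma exp_moment_cong_distr:
  assumes "random_variable borel X" "random_variable borel X'" "distr M borel X = distr M borel X'"
  shows "exp_moment M X (ereal h) = exp_moment M X' (ereal h)"
proof -
  have "exp_moment M Z (ereal h) = (\<integral>\<^sup>+x. ennreal (exp (h * x)) \<partial>distr M borel Z)"
    if "random_variable borel Z" for Z
    using that by (simp add: exp_moment_ereal nn_integral_distr)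
  with assms show ?thesis by simp
qed

lemma exp_moment_0 [simp]: "exp_moment M X (ereal 0) = 1"
  by (simp add: exp_moment_ereal emeasure_space_1)

lemma exp_moment_pos:
  assumes [measurable]: "random_variable borel X"
  shows "0 < exp_moment M X (ereal h)"
proof -
  have "exp_moment M X (ereal h) \<noteq> 0"
    unfolding exp_moment_ereal by (subst nn_integral_0_iff_AE) (auto simp: ennreal_eq_0_iff)
  then show ?thesis by (simp add: zero_less_iff_neq_zero)
qed

lemma exp_moment_sum:
  assumes "indep_vars (\<lambda>_. borel) X I" "finite I"
  shows "exp_moment M (\<lambda>\<omega>. \<Sum>j\<in>I. X j \<omega>) (ereal h) = (\<Prod>j\<in>I. exp_moment M (X j) (ereal h))"
proof -
  have "exp_moment M (\<lambda>\<omega>. \<Sum>j\<in>I. X j \<omega>) (ereal h) = (\<integral>\<^sup>+\<omega>. (\<Prod>j\<in>I. ennreal (exp (h * X j \<omega>))) \<partial>M)"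
    using assms(2) by (simp add: exp_moment_ereal sum_distrib_left exp_sum prod_ennreal)
  also have "\<dots> = (\<Prod>j\<in>I. \<integral>\<^sup>+\<omega>. ennreal (exp (h * X j \<omega>)) \<partial>M)"
    using assms(2) by (intro indep_vars_nn_integral indep_vars_compose2[OF assms(1)]) auto
  finally show ?thesis by (simp add: exp_moment_ereal)
qed

text \<open>The moment is convex in its exponent and equals one at \<open>0\<close>.\<close>

lemma exp_moment_le_max:
  assumes [measurable]: "random_variable borel X" and "0 \<le> \<theta>" "\<theta> \<le> 1"
  shows "exp_moment M X (ereal (\<theta> * h)) \<le> max 1 (exp_moment M X (ereal h))"
proof -
  have "exp (\<theta> * h * z) \<le> (1 - \<theta>) + \<theta> * exp (h * z)" for z
    using convex_onD[OF exp_convex, of \<theta> 0 "h * z"] assms(2,3) by (simp add: mult.assoc)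
  then have "ennreal (exp (\<theta> * h * z)) \<le> ennreal (1 - \<theta>) + ennreal \<theta> * ennreal (exp (h * z))" for z
    using assms(2,3) by (simp add: ennreal_mult[symmetric] ennreal_plus[symmetric] del: ennreal_plus)
  then have "exp_moment M X (ereal (\<theta> * h))
      \<le> (\<integral>\<^sup>+\<omega>. ennreal (1 - \<theta>) + ennreal \<theta> * ennreal (exp (h * X \<omega>)) \<partial>M)"
    unfolding exp_moment_ereal by (intro nn_integral_mono) auto
  also have "\<dots> = ennreal (1 - \<theta>) + ennreal \<theta> * exp_moment M X (ereal h)"
    by (simp add: nn_integral_add nn_integral_cmult exp_moment_ereal emeasure_space_1)
  also have "\<dots> \<le> ennreal (1 - \<theta>) * max 1 (exp_moment M X (ereal h))
      + ennreal \<theta> * max 1 (exp_moment M X (ereal h))"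
    using mult_left_mono[of 1 "max 1 (exp_moment M X (ereal h))" "ennreal (1 - \<theta>)"]
    by (intro add_mono mult_left_mono) auto
  also have "\<dots> = max 1 (exp_moment M X (ereal h))"
    using assms(2,3) by (simp add: distrib_right[symmetric] ennreal_plus[symmetric] del: ennreal_plus)
  finally show ?thesis .
qed

text \<open>Convexity makes the exponents with moment at most one an interval starting at zero;
  Fatou's lemma along exponents increasing to \<open>h\<close> shows that a finite supremum belongs
  to it.\<close>

lemma exp_moment_le_1_below_exponent:
  assumes [measurable]: "random_variable borel X"
    and "0 \<le> h" and h: "ereal h \<le> lundberg_exponent M X"
  shows "exp_moment M X (ereal h) \<le> 1"
proof (cases "h = 0")
  case False
  with assms have "0 < h" by simp
  have below: "exp_moment M X (ereal g) \<le> 1" if "0 \<le> g" "g < h" for g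
  proof -
    have "ereal g < lundberg_exponent M X"
      using that h by (metis ereal_less_eq(3) less_le_trans less_ereal.simps(1))
    then obtain g' where g': "g < g'" "exp_moment M X (ereal g') \<le> 1"
      unfolding lundberg_exponent_def by (auto simp: less_SUP_iff)
    \<comment> \<open>Convexity with \<open>\<theta> = g / g'\<close> bounds the moment at
      \<open>g\<close> by the maximum of one and the moment at \<open>g'\<close>.\<close>
    then show ?thesis
      using exp_moment_le_max[OF assms(1), of "g / g'" g'] that by (auto simp: max_def split: if_splits)
  qed
  define g where "g n = h * (1 - 1 / (real n + 1))" for n
  have "g \<longlonglongrightarrow> h * (1 - 0)"
    unfolding g_def using LIMSEQ_inverse_real_of_nat
    by (intro tendsto_intros) (simp add: inverse_eq_divide add.commute)
  then have g: "g \<longlonglongrightarrow> h" by simp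
  have "exp_moment M X (ereal h) = (\<integral>\<^sup>+\<omega>. liminf (\<lambda>n. ennreal (exp (g n * X \<omega>))) \<partial>M)"
    unfolding exp_moment_ereal using g
    by (intro nn_integral_cong lim_imp_Liminf[symmetric] tendsto_intros tendsto_ennrealI) auto
  also have "\<dots> \<le> liminf (\<lambda>n. \<integral>\<^sup>+\<omega>. ennreal (exp (g n * X \<omega>)) \<partial>M)"
    by (intro nn_integral_liminf) auto
  also have "\<dots> \<le> liminf (\<lambda>n. 1)"
  proof (intro Liminf_mono always_eventually allI)
    fix n
    have "0 \<le> g n" "g n < h"
      using \<open>0 < h\<close> by (auto simp: g_def field_simps)
    then show "(\<integral>\<^sup>+\<omega>. ennreal (exp (g n * X \<omega>)) \<partial>M) \<le> 1"
      using below by (simp add: exp_moment_ereal)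
  qed
  also have "\<dots> = 1" by (simp add: Liminf_const)
  finally show ?thesis .
qed simp

lemma exp_ext_simps [simp]: "exp_ext \<infinity> = \<infinity>" "exp_ext (-\<infinity>) = 0" "exp_ext 0 = 1"
  by (simp_all add: exp_ext_def zero_ereal_def)

lemma exp_ext_infinity_times:
  "exp_ext (\<infinity> * ereal x) = (if 0 < x then \<infinity> else if x = 0 then 1 else 0)"
  by auto

text \<open>The integrand at exponent \<infinity> is infinite where \<open>X > 0\<close>, so a
  finite integral forces \<open>X \<le> 0\<close> almost surely.\<close>

lemma exp_moment_le_1_of_infinite_exponent:
  assumes [measurable]: "random_variable borel X"
    and "exp_moment M X \<infinity> < \<infinity>" "0 \<le> h"
  shows "exp_moment M X (ereal h) \<le> 1"
proof -
  have "AE \<omega> in M. exp_ext (\<infinity> * ereal (X \<omega>)) \<noteq> \<infinity>"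
    using assms(2) unfolding exp_moment_def exp_ext_infinity_times
    by (intro nn_integral_PInf_AE) auto
  then have "AE \<omega> in M. ennreal (exp (h * X \<omega>)) \<le> 1"
    by eventually_elim (use assms(3) in \<open>auto simp: exp_ext_infinity_times mult_nonneg_nonpos split: if_splits\<close>)
  then have "exp_moment M X (ereal h) \<le> (\<integral>\<^sup>+\<omega>. 1 \<partial>M)"
    unfolding exp_moment_ereal by (intro nn_integral_mono_AE)
  then show ?thesis by (simp add: emeasure_space_1)
qed

section \<open>Maximal inequality for partial sums of independent variables\<close>

text \<open>This is the product formula for a family indexed by \<open>bool\<close>. It serves to
  separate the next increment from the past in the stopping argument.\<close>

lemma indep_var_nn_integral_mult:
  fixes X Z :: "'a \<Rightarrow> ennreal"
  assumes "indep_var borel X borel Z"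
  shows "(\<integral>\<^sup>+\<omega>. X \<omega> * Z \<omega> \<partial>M) = (\<integral>\<^sup>+\<omega>. X \<omega> \<partial>M) * (\<integral>\<^sup>+\<omega>. Z \<omega> \<partial>M)"
proof -
  have "case_bool borel borel = (\<lambda>_. borel :: ennreal measure)"
    by (simp add: fun_eq_iff split: bool.split)
  then have "indep_vars (\<lambda>_. borel) (case_bool X Z) UNIV"
    using assms by (simp add: indep_var_def)
  from indep_vars_nn_integral[OF _ this] show ?thesis
    by (simp add: UNIV_bool mult.commute)
qed

text \<open>
  The left-hand side of \<open>bound\<close> is the expectation of \<open>C exp (h S\<^sub>n) / E exp (h S\<^sub>n)\<close> stopped at the
  first exceedance of \<open>u\<close>, with the stopped value bounded below by \<open>exp (h u)\<close>.
\<close>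

lemma exceedance_bound:
  fixes X :: "nat \<Rightarrow> 'a \<Rightarrow> real" and h u :: real and C :: ennreal
  defines "S \<equiv> \<lambda>n \<omega>. \<Sum>j=1..n. X j \<omega>"
  assumes ind: "indep_vars (\<lambda>_. borel) X {1..}" and h: "0 \<le> h"
    and C: "\<And>k. 1 \<le> k \<Longrightarrow> exp_moment M (S k) (ereal h) \<le> C"
  shows "emeasure M {\<omega>\<in>space M. \<exists>k\<ge>1. u < S k \<omega>} \<le> ennreal (exp (- h * u)) * C"
proof (cases "C = \<infinity>")
  case True
  then show ?thesis by (simp add: ennreal_mult_top)
next
  case False
  then obtain c where c: "C = ennreal c" "0 \<le> c" by (cases C) auto
  have X [measurable]: "random_variable borel (X j)" if "1 \<le> j" for j
    using ind that by (auto simp: indep_vars_def)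
  have S [measurable]: "random_variable borel (S n)" for n
    unfolding S_def by measurable
  define p where "p n = enn2real (exp_moment M (S n) (ereal h))" for n
  have fin: "exp_moment M (S n) (ereal h) < \<infinity>" for n
  proof (cases "n = 0")
    case True
    then show ?thesis by (simp add: S_def exp_moment_ereal emeasure_space_1)
  next
    case False
    then show ?thesis using C[of n] c by (auto simp: le_less_trans)
  qed
  then have p: "exp_moment M (S n) (ereal h) = ennreal (p n)" for n
    by (simp add: p_def)
  have p_pos: "0 < p n" for n
    using exp_moment_pos[OF S, of n h] unfolding p by (simp add: ennreal_less_zero_iff)
  have p_le: "p n \<le> c" if "1 \<le> n" for n
    using C[OF that] c unfolding p by simp
  have "exp_moment M (S 0) (ereal h) = 1" by (simp add: S_def exp_moment_ereal emeasure_space_1)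
  then have p0: "p 0 = 1" by (simp add: p_def)
  define A where "A n = {\<omega>\<in>space M. \<forall>k\<in>{1..n}. S k \<omega> \<le> u}" for n
  have A [measurable]: "A n \<in> events" for n
    unfolding A_def by measurable
  define J where "J n = (\<integral>\<^sup>+\<omega>. indicator (A n) \<omega> * ennreal (exp (h * S n \<omega>)) \<partial>M)" for n
  have bound: "ennreal (c / p n) * J n + ennreal (exp (h * u)) * emeasure M (space M - A n) \<le> C" for n
  proof (induction n)
    case 0
    have "J 0 \<le> exp_moment M (S 0) (ereal h)"
      unfolding J_def exp_moment_ereal by (intro nn_integral_mono) (auto split: split_indicator)
    then have "ennreal c * J 0 \<le> ennreal c * 1"
      unfolding p p0 by (intro mult_left_mono) auto
    \<comment> \<open>The range \<open>{1..0}\<close> is empty, so nothing has been exceeded yet and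
      the second summand vanishes.\<close>
    moreover have "A 0 = space M" by (auto simp: A_def)
    ultimately show ?case by (simp add: p0 c)
  next
    case (Suc n)
    \<comment> \<open>The integrand of \<open>J n\<close>, written as a measurable function of the
      first \<open>n\<close> increments alone, which makes it independent of
      \<open>X (Suc n)\<close>.\<close>
    define F where "F = (\<lambda>f::nat \<Rightarrow> real. indicator {f. \<forall>k\<in>{1..n}. (\<Sum>j=1..k. f j) \<le> u} f
      * ennreal (exp (h * (\<Sum>j=1..n. f j))))"
    define m where "m = exp_moment M (X (Suc n)) (ereal h)"
    have F: "F \<in> borel_measurable (PiM {1..n} (\<lambda>_. borel))"
      unfolding F_def by measurable
    have "indep_var borel (F \<circ> (\<lambda>\<omega>. restrict (\<lambda>i. X i \<omega>) {1..n}))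
        borel ((\<lambda>f. ennreal (exp (h * f (Suc n)))) \<circ> (\<lambda>\<omega>. restrict (\<lambda>i. X i \<omega>) {Suc n}))"
      by (intro indep_var_compose[OF indep_var_restrict[OF ind] F]) auto
    from indep_var_nn_integral_mult[OF this]
    have "(\<integral>\<^sup>+\<omega>. F (restrict (\<lambda>i. X i \<omega>) {1..n}) * ennreal (exp (h * X (Suc n) \<omega>)) \<partial>M)
        = (\<integral>\<^sup>+\<omega>. F (restrict (\<lambda>i. X i \<omega>) {1..n}) \<partial>M) * m"
      unfolding m_def exp_moment_ereal by (simp only: comp_def restrict_apply' singletonI)
    moreover have FA: "F (restrict (\<lambda>i. X i \<omega>) {1..n}) = indicator (A n) \<omega> * ennreal (exp (h * S n \<omega>))"
      if "\<omega> \<in> space M" for \<omega>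
    proof -
      have "(\<Sum>j=1..k. restrict (\<lambda>i. X i \<omega>) {1..n} j) = S k \<omega>" if "k \<le> n" for k
        unfolding S_def using that by (intro sum.cong) auto
      then show ?thesis using that unfolding F_def A_def by (auto split: split_indicator)
    qed
    ultimately have split: "J n * m = (\<integral>\<^sup>+\<omega>. indicator (A n) \<omega> * ennreal (exp (h * S (Suc n) \<omega>)) \<partial>M)"
      unfolding J_def
      by (simp add: FA S_def algebra_simps exp_add ennreal_mult mult.assoc cong: nn_integral_cong)
    have "exp_moment M (S (Suc n)) (ereal h) = exp_moment M (S n) (ereal h) * m"
      unfolding S_def m_def
      by (subst (1 2) exp_moment_sum[OF indep_vars_subset[OF ind]]) (auto simp: mult.commute)
    then have pm: "ennreal (p (Suc n)) = ennreal (p n) * m" unfolding p .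
    have "ennreal (c / p (Suc n)) * ennreal (p (Suc n)) = ennreal (c / p n) * ennreal (p n)"
      using c p_pos[of n] p_pos[of "Suc n"] by (simp add: ennreal_mult[symmetric])
    then have "ennreal (p n) * (ennreal (c / p (Suc n)) * m) = ennreal (p n) * ennreal (c / p n)"
      unfolding pm by (simp add: ac_simps)
    \<comment> \<open>The martingale property in terms of weights: averaging over the new increment
      turns the weight for \<open>Suc n\<close> into the one for \<open>n\<close>. Cancelling
      \<open>p n\<close> is legitimate since it is positive and finite.\<close>
    then have cm: "ennreal (c / p (Suc n)) * m = ennreal (c / p n)"
      using p_pos[of n] by (subst (asm) ennreal_mult_cancel_left) (auto simp: ennreal_eq_0_iff)
    let ?w = "ennreal (c / p (Suc n))" and ?e = "ennreal (exp (h * u))"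
    have sub: "A (Suc n) \<subseteq> A n" by (auto simp: A_def)
    have "?w * J (Suc n) + ?e * emeasure M (A n - A (Suc n))
      = (\<integral>\<^sup>+\<omega>. ?w * (indicator (A (Suc n)) \<omega> * ennreal (exp (h * S (Suc n) \<omega>)))
            + ?e * indicator (A n - A (Suc n)) \<omega> \<partial>M)"
      unfolding J_def by (simp add: nn_integral_add nn_integral_cmult)
    also have "\<dots> \<le> (\<integral>\<^sup>+\<omega>. ?w * (indicator (A n) \<omega> * ennreal (exp (h * S (Suc n) \<omega>))) \<partial>M)"
    proof (intro nn_integral_mono)
      fix \<omega> assume "\<omega> \<in> space M"
      show "?w * (indicator (A (Suc n)) \<omega> * ennreal (exp (h * S (Suc n) \<omega>)))
            + ?e * indicator (A n - A (Suc n)) \<omega>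
          \<le> ?w * (indicator (A n) \<omega> * ennreal (exp (h * S (Suc n) \<omega>)))"
      proof (cases "\<omega> \<in> A n - A (Suc n)")
        case True
        \<comment> \<open>Here the level is first exceeded at \<open>Suc n\<close>. The exponential
          is then at least \<open>exp (h * u)\<close>, and its weight is at least one because
          \<open>c\<close> bounds every mean from index one on.\<close>
        then have "u < S (Suc n) \<omega>" by (auto simp: A_def le_Suc_eq)
        then have "exp (h * u) \<le> exp (h * S (Suc n) \<omega>)" using h by (simp add: mult_left_mono)
        moreover have "1 \<le> c / p (Suc n)" using p_le[of "Suc n"] p_pos[of "Suc n"] by simp
        ultimately have "1 * exp (h * u) \<le> c / p (Suc n) * exp (h * S (Suc n) \<omega>)"
          by (intro mult_mono) auto
        then have "?e \<le> ?w * ennreal (exp (h * S (Suc n) \<omega>))"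
          by (metis ennreal_leI ennreal_mult'' exp_ge_zero mult_1)
        then show ?thesis using True by simp
      next
        case False
        then show ?thesis using sub by (auto split: split_indicator)
      qed
    qed
    also have "\<dots> = ?w * (J n * m)" unfolding split by (simp add: nn_integral_cmult)
    also have "\<dots> = ennreal (c / p n) * J n" unfolding cm[symmetric] by (simp add: ac_simps)
    finally have step: "?w * J (Suc n) + ?e * emeasure M (A n - A (Suc n)) \<le> ennreal (c / p n) * J n" .
    have "space M - A (Suc n) = (space M - A n) \<union> (A n - A (Suc n))"
      using sub by (auto simp: A_def)
    then have "emeasure M (space M - A (Suc n)) = emeasure M (space M - A n) + emeasure M (A n - A (Suc n))"
      by (simp only:) (intro plus_emeasure[symmetric]; auto)
    then have "?w * J (Suc n) + ?e * emeasure M (space M - A (Suc n))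
        = (?w * J (Suc n) + ?e * emeasure M (A n - A (Suc n))) + ?e * emeasure M (space M - A n)"
      by (simp add: distrib_left ac_simps)
    also have "\<dots> \<le> ennreal (c / p n) * J n + ?e * emeasure M (space M - A n)"
      using step by (intro add_right_mono)
    finally show ?case using Suc.IH by (rule order_trans)
  qed
  have le: "emeasure M (space M - A n) \<le> ennreal (exp (- h * u)) * C" for n
  proof -
    \<comment> \<open>The contribution of the paths that have not exceeded \<open>u\<close> is
      nonnegative and is dropped.\<close>
    have "ennreal (exp (h * u)) * emeasure M (space M - A n) \<le> C"
      using bound[of n] by (rule order_trans[rotated]) simp
    then have "ennreal (exp (- h * u)) * (ennreal (exp (h * u)) * emeasure M (space M - A n))
        \<le> ennreal (exp (- h * u)) * C" by (rule mult_left_mono) simp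
    then show ?thesis
      by (simp add: mult.assoc[symmetric] ennreal_mult[symmetric] exp_add[symmetric])
  qed
  have "{\<omega>\<in>space M. \<exists>k\<ge>1. u < S k \<omega>} = (\<Union>n. space M - A n)"
  proof (intro set_eqI iffI)
    fix \<omega> assume "\<omega> \<in> {\<omega>\<in>space M. \<exists>k\<ge>1. u < S k \<omega>}"
    then obtain k where "\<omega> \<in> space M" "1 \<le> k" "u < S k \<omega>" by auto
    then have "\<omega> \<in> space M - A k" unfolding A_def by (auto intro!: bexI[of _ k])
    then show "\<omega> \<in> (\<Union>n. space M - A n)" by blast
  qed (auto simp: A_def not_le)
  \<comment> \<open>The complements of \<open>A n\<close> increase with \<open>n\<close>, so
    continuity from below passes the uniform bound to the union.\<close>
  also have "emeasure M \<dots> = (SUP n. emeasure M (space M - A n))"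
    by (intro SUP_emeasure_incseq[symmetric]) (auto simp: incseq_def A_def)
  also have "\<dots> \<le> ennreal (exp (- h * u)) * C" using le by (rule SUP_least)
  finally show ?thesis .
qed

end

section \<open>Ruin probability bounded by moments of the discounted sums\<close>

context risk_reserve
begin

lemma Y_star_measurable [measurable]: "1 \<le> j \<Longrightarrow> random_variable borel (Y_star \<alpha> Y j)"
  using Y_star_indep by (auto simp: indep_vars_def)

lemma S_star_measurable [measurable]: "random_variable borel (S_star r \<alpha> Y k)"
  unfolding S_star_def by measurable

lemma discounted_indep:
  "indep_vars (\<lambda>_. borel) (\<lambda>j \<omega>. discount r (j - 1) * Y_star \<alpha> Y j \<omega>) {1..}"
  by (intro indep_vars_compose2[OF Y_star_indep]) auto

lemma exp_moment_S_star:
  "exp_moment M (S_star r \<alpha> Y k) (ereal h)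
    = (\<Prod>j=1..k. exp_moment M (Y_star \<alpha> Y j) (ereal (h * discount r (j - 1))))"
proof -
  have "exp_moment M (S_star r \<alpha> Y k) (ereal h)
      = (\<Prod>j=1..k. exp_moment M (\<lambda>\<omega>. discount r (j - 1) * Y_star \<alpha> Y j \<omega>) (ereal h))"
    unfolding S_star_def
    by (intro exp_moment_sum indep_vars_subset[OF discounted_indep]) auto
  then show ?thesis by (simp add: exp_moment_scale)
qed

text \<open>The conditioning event has probability one.\<close>

lemma ruin_prob_eq: "ruin_prob M R u = prob {\<omega>\<in>space M. ruin R \<omega>}"
proof -
  have [measurable]: "random_variable borel (R 0)" "{\<omega>\<in>space M. ruin R \<omega>} \<in> events"
    using R_measurable ruin_measurable by auto
  have "prob {\<omega>\<in>space M. R 0 \<omega> = u} = 1" using R_init by (subst prob_Collect_eq_1) auto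
  moreover have "prob {\<omega>\<in>space M. ruin R \<omega> \<and> R 0 \<omega> = u} = prob {\<omega>\<in>space M. ruin R \<omega>}"
    using R_init by (intro measure_eq_AE) auto
  ultimately show ?thesis by (simp add: ruin_prob_def cond_prob_def)
qed

text \<open>The two pathwise lemmas apply outside one null set, since the conditions imposed for
  each \<open>k\<close> are countable in number. The sequence \<open>R (T k)\<close> starts at
  \<open>u\<close> because \<open>T 0 = 0\<close>.\<close>

lemma ruin_imp_S_star_exceeds:
  assumes "no_recovery_jumps M R T"
  shows "AE \<omega> in M. ruin R \<omega> \<longrightarrow> (\<exists>k\<ge>1. u < S_star r \<alpha> Y k \<omega>)"
proof -
  have "AE \<omega> in M. \<forall>k. 1 \<le> k \<longrightarrow> R (T k \<omega>) \<omega> \<ge> (1 + \<alpha> k \<omega>) * R (T (k - 1) \<omega>) \<omega> - Y k \<omega>"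
    using R_step by (simp add: AE_all_countable)
  moreover have "AE \<omega> in M. \<forall>k. 1 \<le> k \<longrightarrow> r k \<le> \<alpha> k \<omega>"
    using \<alpha>_ge_r by (simp add: AE_all_countable)
  ultimately show ?thesis
    using assms[unfolded no_recovery_jumps_def] R_init T_zero T_increasing T_unbounded piecewise_monotone
  proof eventually_elim
    case (elim \<omega>)
    show ?case
    proof
      assume "ruin R \<omega>"
      then obtain t where t: "0 \<le> t" "R t \<omega> < 0"
        by (auto simp: ruin_def INF_less_iff)
      obtain n where "R (T n \<omega>) \<omega> < 0"
        using negative_at_grid_time[of "\<lambda>k. T k \<omega>" "\<lambda>s. R s \<omega>" t] elim t by blast
      then show "\<exists>k\<ge>1. u < S_star r \<alpha> Y k \<omega>"
        using first_negative_imp_sum_exceeds[of "\<lambda>k. R (T k \<omega>) \<omega>" "\<lambda>k. \<alpha> k \<omega>" "\<lambda>k. Y k \<omega>" r n]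
          elim u_pos r_nonneg
        by (simp add: S_star_def Y_star_def)
    qed
  qed
qed

lemma ruin_prob_le:
  assumes "no_recovery_jumps M R T" "0 \<le> h"
  shows "ennreal (ruin_prob M R u)
    \<le> ennreal (exp (- h * u)) * (SUP k\<in>{1..}. exp_moment M (S_star r \<alpha> Y k) (ereal h))"
proof -
  have "ennreal (ruin_prob M R u) = emeasure M {\<omega>\<in>space M. ruin R \<omega>}"
    by (simp add: ruin_prob_eq emeasure_eq_measure)
  also have "\<dots> \<le> emeasure M {\<omega>\<in>space M. \<exists>k\<ge>1. u < S_star r \<alpha> Y k \<omega>}"
    using ruin_imp_S_star_exceeds[OF assms(1)] by (intro emeasure_mono_AE) auto
  \<comment> \<open>The maximal inequality is used with the supremum itself as the constant
    \<open>C\<close>.\<close>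
  also have "\<dots> \<le> ennreal (exp (- h * u)) * (SUP k\<in>{1..}. exp_moment M (S_star r \<alpha> Y k) (ereal h))"
    unfolding S_star_def
    by (intro exceedance_bound[OF discounted_indep assms(2)] SUP_upper) auto
  finally show ?thesis .
qed

end

section \<open>Periodicity and reduction to finitely many moments\<close>

locale periodic_risk_reserve = risk_reserve +
  fixes q :: real and l :: nat
  assumes l_pos: "1 \<le> l"
    and q_pos: "0 < q"
    and Y_star_periodic: "\<And>n. 1 \<le> n \<Longrightarrow>
      distr M borel (Y_star \<alpha> Y (n + l)) = distr M borel (\<lambda>\<omega>. q * Y_star \<alpha> Y n \<omega>)"
    and q_discount_le_1: "q * discount r l \<le> 1"
    and r_periodic: "\<And>n. 1 \<le> n \<Longrightarrow> r (n + l) = r n"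
begin

abbreviation moment :: "nat \<Rightarrow> real \<Rightarrow> ennreal" where
  "moment k h \<equiv> exp_moment M (S_star r \<alpha> Y k) (ereal h)"

abbreviation "L \<equiv> lundberg_exponent M (S_star r \<alpha> Y l)"

lemma moment_index_0 [simp]: "moment 0 h = 1"
  by (simp add: exp_moment_S_star)

lemma discount_add_period: "discount r (n + l) = discount r l * discount r n"
proof (induction n)
  case (Suc n)
  then show ?case using r_periodic[of "Suc n"] by (simp add: discount_def)
qed (simp add: discount_def)

text \<open>By independence the moment is a product, cut here after \<open>l\<close> factors. In a
  later factor, the shift by \<open>l\<close> contributes \<open>q\<close> through the distribution
  and \<open>discount r l\<close> through the weight.\<close>

lemma moment_add_period: "moment (l + k) h = moment l h * moment k (q * discount r l * h)"
proof -
  let ?\<phi> = "\<lambda>j h. exp_moment M (Y_star \<alpha> Y j) (ereal h)"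
  have *: "?\<phi> (n + l) g = ?\<phi> n (g * q)" if "1 \<le> n" for n g
    using exp_moment_cong_distr[OF _ _ Y_star_periodic[OF that], of g] that
    by (simp add: exp_moment_scale)
  have "moment (l + k) h = moment l h * (\<Prod>j=l+1..l+k. ?\<phi> j (h * discount r (j - 1)))"
    unfolding exp_moment_S_star by (rule prod.ub_add_nat) simp
  also have "(\<Prod>j=l+1..l+k. ?\<phi> j (h * discount r (j - 1)))
      = (\<Prod>j=1..k. ?\<phi> (j + l) (h * discount r (j + l - 1)))"
    by (rule prod.reindex_bij_witness[of _ "\<lambda>j. j + l" "\<lambda>j. j - l"]) auto
  also have "\<dots> = moment k (q * discount r l * h)"
    unfolding exp_moment_S_star
  proof (intro prod.cong refl)
    fix j assume "j \<in> {1..k}"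
    then have "1 \<le> j" "j + l - 1 = (j - 1) + l" by auto
    then show "?\<phi> (j + l) (h * discount r (j + l - 1)) = ?\<phi> j (q * discount r l * h * discount r (j - 1))"
      by (simp only: * discount_add_period) (simp add: ac_simps)
  qed
  finally show ?thesis .
qed

lemma moment_period_le_1: "0 \<le> h \<Longrightarrow> ereal h \<le> L \<Longrightarrow> moment l h \<le> 1"
  by (rule exp_moment_le_1_below_exponent) auto

lemma q_discount_nonneg: "0 \<le> q * discount r l"
  using q_pos r_nonneg unfolding discount_def by (intro mult_nonneg_nonneg prod_nonneg) auto

text \<open>Strong induction removes one period at a time: its factor is at most one, and the
  shrunken exponent of the rest is handled by convexity.\<close>

lemma moment_le_Max:
  assumes "0 \<le> h" "ereal h \<le> L"
  shows "moment n h \<le> (MAX k\<in>{..<l}. moment k h)"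
proof (induction n rule: less_induct)
  case (less n)
  show ?case
  proof (cases "n < l")
    case True
    then show ?thesis by (intro Max_ge) auto
  next
    case False
    then have "moment n h = moment l h * moment (n - l) (q * discount r l * h)"
      using moment_add_period[of "n - l" h] by simp
    also have "\<dots> \<le> 1 * moment (n - l) (q * discount r l * h)"
      by (intro mult_right_mono moment_period_le_1 assms) auto
    also have "\<dots> \<le> max 1 (moment (n - l) h)"
      using exp_moment_le_max[OF S_star_measurable q_discount_nonneg q_discount_le_1] by simp
    also have "\<dots> \<le> (MAX k\<in>{..<l}. moment k h)"
    proof (rule max.boundedI)
      \<comment> \<open>The constant one from convexity is the moment at index zero, which lies in
        the range since \<open>l \<ge> 1\<close>.\<close>
      have "moment 0 h \<le> (MAX k\<in>{..<l}. moment k h)" by (intro Max_ge imageI) (use l_pos in auto)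
      then show "1 \<le> (MAX k\<in>{..<l}. moment k h)" by simp
      show "moment (n - l) h \<le> (MAX k\<in>{..<l}. moment k h)"
        using False l_pos by (intro less.IH) auto
    qed
    finally show ?thesis .
  qed
qed

text \<open>When \<open>q * discount r l = 1\<close>, removing a period leaves the exponent
  unchanged. The competitor one from convexity does not arise, and the induction ends at an index
  between \<open>1\<close> and \<open>l\<close>.\<close>

lemma SUP_moment_eq_Max:
  assumes "q * discount r l = 1" "0 \<le> h" "ereal h \<le> L"
  shows "(SUP k\<in>{1..}. moment k h) = (MAX k\<in>{1..l}. moment k h)"
proof (rule antisym)
  have "moment n h \<le> (MAX k\<in>{1..l}. moment k h)" if "1 \<le> n" for n
    using that
  proof (induction n rule: less_induct)
    case (less n)
    show ?case
    proof (cases "n \<le> l")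
      case True
      then show ?thesis using less.prems by (intro Max_ge) auto
    next
      case False
      then have "moment n h = moment l h * moment (n - l) h"
        using moment_add_period[of "n - l" h] assms(1) by simp
      also have "\<dots> \<le> 1 * moment (n - l) h"
        by (intro mult_right_mono moment_period_le_1 assms) auto
      also have "\<dots> \<le> (MAX k\<in>{1..l}. moment k h)"
        unfolding mult_1_left using False l_pos by (intro less.IH) auto
      finally show ?thesis .
    qed
  qed
  then show "(SUP k\<in>{1..}. moment k h) \<le> (MAX k\<in>{1..l}. moment k h)"
    by (intro SUP_least) auto
  show "(MAX k\<in>{1..l}. moment k h) \<le> (SUP k\<in>{1..}. moment k h)"
    using l_pos by (intro Max.boundedI) (auto intro!: SUP_upper)
qed

text \<open>For finite \<open>L\<close> the choice \<open>h = L\<close> is admissible. The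
  assumption excludes the indeterminate product of an infinite constant and
  \<open>exp_ext (- \<infinity>) = 0\<close>.\<close>

lemma INF_le_Lundberg:
  defines "C\<^sub>3 \<equiv> (MAX k\<in>{..<l}. exp_moment M (S_star r \<alpha> Y k) L)"
  assumes "L < \<infinity> \<or> C\<^sub>3 < \<infinity>"
  shows "(INF h\<in>{h::real. 0 \<le> h \<and> ereal h \<le> L}.
      ennreal (exp (- h * u)) * (MAX k\<in>{..<l}. moment k h)) \<le> C\<^sub>3 * exp_ext (- (L * ereal u))"
    (is "?I \<le> _")
proof -
  have "ereal 0 \<le> L" unfolding lundberg_exponent_def by (intro SUP_upper) simp
  then consider g where "L = ereal g" "0 \<le> g" | "L = \<infinity>" by (cases L) auto
  then show ?thesis
  proof cases
    case 1
    then have "?I \<le> ennreal (exp (- g * u)) * (MAX k\<in>{..<l}. moment k g)"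
      by (intro INF_lower) auto
    then show ?thesis using 1 by (simp add: C\<^sub>3_def exp_ext_def mult.commute)
  next
    case 2
    \<comment> \<open>The right-hand side is now zero, so the infimum must be shown to vanish.
      Finiteness of the constant bounds all moments involved by one, and every natural number is an
      admissible exponent.\<close>
    with assms have "C\<^sub>3 < \<infinity>" by simp
    have "exp_moment M (S_star r \<alpha> Y k) \<infinity> < \<infinity>" if "k < l" for k
    proof -
      have "exp_moment M (S_star r \<alpha> Y k) L \<le> C\<^sub>3"
        unfolding C\<^sub>3_def using that by (intro Max_ge imageI) auto
      then show ?thesis using \<open>C\<^sub>3 < \<infinity>\<close> 2 by (simp add: le_less_trans)
    qed
    then have Max_le_1: "(MAX k\<in>{..<l}. moment k h) \<le> 1" if "0 \<le> h" for h
      using that l_pos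
      by (intro Max.boundedI) (auto intro!: exp_moment_le_1_of_infinite_exponent simp: lessThan_empty_iff)
    have "?I \<le> ennreal (exp (- real n * u))" for n
    proof -
      have "?I \<le> ennreal (exp (- real n * u)) * (MAX k\<in>{..<l}. moment k (real n))"
        using 2 by (intro INF_lower) auto
      also have "\<dots> \<le> ennreal (exp (- real n * u)) * 1"
        by (intro mult_left_mono Max_le_1) auto
      finally show ?thesis by simp
    qed
    moreover have "(\<lambda>n. ennreal (exp (- real n * u))) \<longlonglongrightarrow> ennreal 0"
    proof (rule tendsto_ennrealI)
      have "(\<lambda>n. exp (- u) ^ n) \<longlonglongrightarrow> 0" using u_pos by (intro LIMSEQ_realpow_zero) auto
      then show "(\<lambda>n. exp (- real n * u)) \<longlonglongrightarrow> 0"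
        by (simp add: exp_of_nat_mult[symmetric])
    qed
    ultimately have "?I \<le> 0" by (intro LIMSEQ_le_const) auto
    then show ?thesis by simp
  qed
qed

end

section \<open>Lundberg-type bounds for the periodic reserve process\<close>

theorem theorem3:
  fixes M :: "'a measure"
    and R :: "real \<Rightarrow> 'a \<Rightarrow> real"
    and u q :: real
    and T \<alpha> Y :: "nat \<Rightarrow> 'a \<Rightarrow> real"
    and r :: "nat \<Rightarrow> real"
    and l :: nat
  defines "S \<equiv> S_star r \<alpha> Y"
    and "v \<equiv> discount r"
    and "L \<equiv> lundberg_exponent M (S_star r \<alpha> Y l)"
    and "C\<^sub>3 \<equiv> (MAX k\<in>{..<l}. exp_moment M (S_star r \<alpha> Y k) (lundberg_exponent M (S_star r \<alpha> Y l)))"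
  assumes "risk_reserve M R u T \<alpha> Y r"
    and "no_recovery_jumps M R T"
    and "1 \<le> l"
    and "0 < q"
    and "\<And>n. 1 \<le> n \<Longrightarrow>
           distr M borel (Y_star \<alpha> Y (n + l)) = distr M borel (\<lambda>\<omega>. q * Y_star \<alpha> Y n \<omega>)"
    and "q * v l \<le> 1"
    and "\<And>n. 1 \<le> n \<Longrightarrow> r (n + l) = r n"
  shows "(\<forall>h::real. 0 \<le> h \<and> ereal h \<le> L \<longrightarrow>
            ennreal (ruin_prob M R u)
              \<le> ennreal (exp (- h * u)) * (SUP k\<in>{1..}. exp_moment M (S k) (ereal h)) \<and>
            ennreal (exp (- h * u)) * (SUP k\<in>{1..}. exp_moment M (S k) (ereal h))
              = ennreal (exp (- h * u)) *
                  (SUP k\<in>{1..}. \<Prod>j=1..k. exp_moment M (Y_star \<alpha> Y j) (ereal (h * v (j - 1)))) \<and>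
            (SUP k\<in>{1..}. exp_moment M (S k) (ereal h))
              \<le> (MAX k\<in>{..<l}. exp_moment M (S k) (ereal h)))
       \<and> ennreal (ruin_prob M R u)
            \<le> (INF h\<in>{h::real. 0 \<le> h \<and> ereal h \<le> L}.
                 ennreal (exp (- h * u)) * (MAX k\<in>{..<l}. exp_moment M (S k) (ereal h)))
       \<and> (L < \<infinity> \<or> C\<^sub>3 < \<infinity> \<longrightarrow>
            (INF h\<in>{h::real. 0 \<le> h \<and> ereal h \<le> L}.
               ennreal (exp (- h * u)) * (MAX k\<in>{..<l}. exp_moment M (S k) (ereal h)))
              \<le> C\<^sub>3 * exp_ext (- (L * ereal u)))
       \<and> (q * v l = 1 \<longrightarrow> (\<forall>h::real. 0 \<le> h \<and> ereal h \<le> L \<longrightarrow>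
            (SUP k\<in>{1..}. exp_moment M (S k) (ereal h))
              = (MAX k\<in>{1..l}. exp_moment M (S k) (ereal h))))"
proof -
  interpret risk_reserve M R u T \<alpha> Y r by fact
  interpret periodic_risk_reserve M R u T \<alpha> Y r q l
    using assms(7-11) unfolding v_def by unfold_locales auto
  have SUP_le: "(SUP k\<in>{1..}. moment k h) \<le> (MAX k\<in>{..<l}. moment k h)"
    if "0 \<le> h" "ereal h \<le> L" for h
    using that unfolding L_def by (intro SUP_least moment_le_Max)
  have ruin: "ennreal (ruin_prob M R u) \<le> ennreal (exp (- h * u)) * (SUP k\<in>{1..}. moment k h)"
    if "0 \<le> h" for h
    using ruin_prob_le[OF assms(6) that] .
  have ruin_INF: "ennreal (ruin_prob M R u) \<le> (INF h\<in>{h::real. 0 \<le> h \<and> ereal h \<le> L}.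
      ennreal (exp (- h * u)) * (MAX k\<in>{..<l}. moment k h))"
  proof (rule INF_greatest)
    fix h assume "h \<in> {h::real. 0 \<le> h \<and> ereal h \<le> L}"
    then have h: "0 \<le> h" "ereal h \<le> L" by auto
    show "ennreal (ruin_prob M R u) \<le> ennreal (exp (- h * u)) * (MAX k\<in>{..<l}. moment k h)"
      \<comment> \<open>Each admissible \<open>h\<close> yields its own bound with the supremum
        replaced by the finite maximum; the infimum collects them.\<close>
      using ruin[OF h(1)] mult_left_mono[OF SUP_le[OF h], of "ennreal (exp (- h * u))"] by simp
  qed
  have prods: "ennreal (exp (- h * u)) * (SUP k\<in>{1..}. moment k h) = ennreal (exp (- h * u)) *
      (SUP k\<in>{1..}. \<Prod>j=1..k. exp_moment M (Y_star \<alpha> Y j) (ereal (h * discount r (j - 1))))" for h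
    by (simp only: exp_moment_S_star)
  show ?thesis
    unfolding S_def C\<^sub>3_def L_def v_def
    by (intro conjI allI impI; (elim conjE)?)
       (rule ruin prods SUP_le[unfolded L_def] ruin_INF[unfolded L_def] INF_le_Lundberg
          SUP_moment_eq_Max; assumption)+
qed

end
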